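(* Let $\Gamma$ be a non-amenable countable group and $\Gamma\curvearrowright^T(X,\mu)$ a probability-measure-preserving action on a standard probability space. Then $h^{\mathrm{naive}}_\mu(T)\in\{0,+\infty\}$.
   Context: For a countable measurable partition $\mathcal P$ of $X$, $H_\mu(\mathcal P)=-\sum_{P\in\mathcal P}\mu(P)\log\mu(P)$ is its Shannon entropy, and for a nonempty finite $W\subset\Gamma$, $\mathcal P^W=\bigvee_{w\in W}(T^w)^{-1}\mathcal P$ (coarsest common refinement). The naive entropy of $\mathcal P$ is $h^{\mathrm{naive}}_\mu(T,\mathcal P)=\inf_W|W|^{-1}H_\mu(\mathcal P^W)$, the infimum over nonempty finite subsets $W\subset\Gamma$. The naive entropy of $T$ is $h^{\mathrm{naive}}_\mu(T)=\sup_{\mathcal P}h^{\mathrm{naive}}_\mu(T,\mathcal P)$, the supremum over all partitions $\mathcal P$ with finite Shannon entropy. *)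

theory Defs
  imports "HOL-Probability.Probability" "HOL-Algebra.Group_Action"
begin

text \<open>
  Amenability of a discrete group: there is a left-invariant, finitely additive probability
  measure defined on all subsets of the group.
\<close>

definition amenable :: "('g, 'b) monoid_scheme \<Rightarrow> bool" where
  "amenable G \<longleftrightarrow> (\<exists>m :: 'g set \<Rightarrow> real.
     (\<forall>A \<subseteq> carrier G. 0 \<le> m A) \<and>
     m (carrier G) = 1 \<and>
     additive (Pow (carrier G)) m \<and>
     (\<forall>g \<in> carrier G. \<forall>A \<subseteq> carrier G. m (g <#\<^bsub>G\<^esub> A) = m A))"

text \<open>
  A standard Borel space is a measurable space whose sigma-algebra is the Borel sigma-algebra of
  some Polish (separable, completely metrizable) topology on the underlying set.
\<close>

definition standard_borel :: "'x measure \<Rightarrow> bool" where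
  "standard_borel M \<longleftrightarrow> (\<exists>\<T> :: 'x topology.
     completely_metrizable_space \<T> \<and> separable_space \<T> \<and>
     topspace \<T> = space M \<and>
     sets M = sigma_sets (space M) {U. openin \<T> U})"

definition standard_prob_space :: "'x measure \<Rightarrow> bool" where
  "standard_prob_space M \<longleftrightarrow> standard_borel M \<and> prob_space M"

text \<open>
  The library's group actions are homomorphisms into the group of bijections of \<open>space M\<close>, so
  each \<open>T g\<close> is \<open>undefined\<close> off \<open>space M\<close>; this is only a normalisation.
  The inverse of \<open>T g\<close> is measurable since it is \<open>T (inv g)\<close>.
\<close>

definition pmp_action ::
    "('g, 'b) monoid_scheme \<Rightarrow> 'x measure \<Rightarrow> ('g \<Rightarrow> 'x \<Rightarrow> 'x) \<Rightarrow> bool" where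
  "pmp_action G M T \<longleftrightarrow> prob_space M \<and> group_action G (space M) T \<and>
     (\<forall>g \<in> carrier G. T g \<in> measurable M M \<and> distr M M (T g) = M)"

definition countable_measurable_partition :: "'x measure \<Rightarrow> 'x set set \<Rightarrow> bool" where
  "countable_measurable_partition M P \<longleftrightarrow>
     partition_on (space M) P \<and> countable P \<and> P \<subseteq> sets M"

text \<open>
  All summands \<open>- \<mu>(A) log \<mu>(A)\<close> are nonnegative for a probability measure (with \<open>0 log 0 = 0\<close>,
  as \<open>ln 0 = 0\<close>), so \<open>ennreal\<close> does not truncate and the unordered sum always exists in
  \<open>[0, \<infinity>]\<close>.
\<close>

definition shannon_entropy :: "'x measure \<Rightarrow> 'x set set \<Rightarrow> ennreal" where
  "shannon_entropy M P = (\<Sum>\<^sub>\<infinity>A\<in>P. ennreal (- (measure M A * ln (measure M A))))"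

definition preimage_partition :: "'x measure \<Rightarrow> ('x \<Rightarrow> 'x) \<Rightarrow> 'x set set \<Rightarrow> 'x set set" where
  "preimage_partition M f P = (\<lambda>A. f -` A \<inter> space M) ` P"

definition iterated_partition ::
    "'x measure \<Rightarrow> ('g \<Rightarrow> 'x \<Rightarrow> 'x) \<Rightarrow> 'x set set \<Rightarrow> 'g set \<Rightarrow> 'x set set" where
  "iterated_partition M T P W = common_refinement ((\<lambda>w. preimage_partition M (T w) P) ` W)"

definition naive_entropy_partition ::
    "('g, 'b) monoid_scheme \<Rightarrow> 'x measure \<Rightarrow> ('g \<Rightarrow> 'x \<Rightarrow> 'x) \<Rightarrow> 'x set set \<Rightarrow> ennreal" where
  "naive_entropy_partition G M T P =
     (INF W \<in> {W. finite W \<and> W \<noteq> {} \<and> W \<subseteq> carrier G}.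
        shannon_entropy M (iterated_partition M T P W) / of_nat (card W))"

definition naive_entropy ::
    "('g, 'b) monoid_scheme \<Rightarrow> 'x measure \<Rightarrow> ('g \<Rightarrow> 'x \<Rightarrow> 'x) \<Rightarrow> ennreal" where
  "naive_entropy G M T =
     (SUP P \<in> {P. countable_measurable_partition M P \<and> shannon_entropy M P < \<infinity>}.
        naive_entropy_partition G M T P)"

end

theory Submission
  imports Defs
begin

text \<open>
  Every value \<open>h(T,P)\<close> of the naive entropy of a partition can be enlarged, by passing to another
  partition, by a factor \<open>c > 1\<close> that depends on the group alone. The supremum \<open>S\<close> of these values
  then satisfies \<open>c S \<le> S\<close>, which leaves only 0 and \<open>\<infinity>\<close>.

  The factor is an expansion constant of the group. A non-amenable group fails the Foelner
  condition: there are a finite \<open>K\<close> and \<open>e > 0\<close> such that \<open>|K F| \<ge> (1 + e) |F|\<close> for all finite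
  \<open>F\<close> (\<open>finite_expansion_if_not_amenable\<close>); otherwise the normalised counting measures of almost
  invariant finite sets would accumulate, by Tychonoff, at an invariant mean. Now let \<open>P\<close> have
  finite entropy and put \<open>Q = P\<^sup>K\<close>. Then \<open>Q\<^sup>F = P\<^bsup>K F\<^esup>\<close>
  (\<open>iterated_partition_iterated_partition\<close>), so that
  \<open>H(Q\<^sup>F) \<ge> |K F| h(T,P) \<ge> (1 + e) |F| h(T,P)\<close>, that is, \<open>h(T,Q) \<ge> (1 + e) h(T,P)\<close>.
  The partition \<open>Q\<close> competes in the supremum because it again has finite entropy
  (\<open>iterated_partition_finite_entropy\<close>): invariance of the measure gives all the \<open>T\<^sup>w\<close>-preimages
  of \<open>P\<close> the entropy of \<open>P\<close>, and a finite join of finite-entropy partitions has finite entropy.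
\<close>

section \<open>Expansion in non-amenable groups\<close>

lemma compact_unit_cube: "compact (PiE UNIV (\<lambda>_. {0..1}) :: ('a \<Rightarrow> real) set)"
proof -
  have "compactin (product_topology (\<lambda>_. euclidean) UNIV) (PiE UNIV (\<lambda>_. {0..1::real}))"
    by (subst compactin_PiE) auto
  then show ?thesis
    by (metis compactin_euclidean_iff euclidean_product_topology)
qed

lemma abs_card_Int_diff_le:
  fixes F F' S :: "'a set"
  assumes "finite F" "finite F'" "card F = card F'"
  shows "\<bar>real (card (S \<inter> F)) - real (card (S \<inter> F'))\<bar> \<le> real (card (F \<union> F')) - real (card F)"
proof -
  have *: "real (card (S \<inter> A)) - real (card (S \<inter> B)) \<le> real (card (A \<union> B)) - real (card B)"
    if "finite A" "finite B" for A B :: "'a set"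
  proof -
    have "card (S \<inter> A) \<le> card ((S \<inter> B) \<union> (A - B))"
      using that by (intro card_mono) auto
    also have "\<dots> \<le> card (S \<inter> B) + card (A - B)"
      by (rule card_Un_le)
    finally have "real (card (S \<inter> A)) \<le> real (card (S \<inter> B)) + real (card (A - B))"
      by linarith
    moreover have "card (A \<union> B) = card B + card (A - B)"
      using that by (metis Un_Diff_cancel Un_commute card_Un_disjoint Diff_disjoint finite_Diff)
    ultimately show ?thesis by simp
  qed
  from *[OF assms(1,2)] *[OF assms(2,1)] assms(3) show ?thesis
    by (simp add: Un_commute abs_le_iff)
qed

text \<open>
  The uniform measure on a finite set that \<open>K\<close> hardly enlarges is almost invariant under every
  \<open>g \<in> K\<close>: \<open>g A \<inter> F\<close> and \<open>g A \<inter> g F\<close> differ only inside the symmetric difference of \<open>F\<close> and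
  \<open>g F\<close>, and the latter intersection is a translate of \<open>A \<inter> F\<close>. Since \<open>\<one> \<in> K\<close>, both \<open>F\<close> and
  \<open>g F\<close> lie in \<open>K F\<close>, which bounds what they do not share.
\<close>

lemma (in group) uniform_measure_almost_invariant:
  assumes F: "finite F" "F \<noteq> {}" "F \<subseteq> carrier G"
    and K: "finite K" "K \<subseteq> carrier G" "\<one> \<in> K" "g \<in> K"
    and small: "real (card (K <#> F)) \<le> (1 + e) * real (card F)"
    and A: "A \<subseteq> carrier G"
  shows "\<bar>real (card ((g <#\<^bsub>G\<^esub> A) \<inter> F)) / real (card F) - real (card (A \<inter> F)) / real (card F)\<bar> \<le> e"
proof -
  have g: "g \<in> carrier G" using K by auto
  have l: "g <#\<^bsub>G\<^esub> B = (\<lambda>x. g \<otimes> x) ` B" for B by (auto simp: l_coset_def)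
  have inj: "inj_on (\<lambda>x. g \<otimes> x) (carrier G)"
    using g by (auto intro!: inj_onI)
  have c1: "card (g <#\<^bsub>G\<^esub> F) = card F"
    unfolding l using inj F by (intro card_image) (auto intro: inj_on_subset)
  have "(g <#\<^bsub>G\<^esub> A) \<inter> (g <#\<^bsub>G\<^esub> F) = g <#\<^bsub>G\<^esub> (A \<inter> F)"
    unfolding l using inj_on_image_Int[OF inj A F(3)] by simp
  also have "card \<dots> = card (A \<inter> F)"
    unfolding l using inj A by (intro card_image) (auto intro: inj_on_subset)
  finally have c2: "card ((g <#\<^bsub>G\<^esub> A) \<inter> (g <#\<^bsub>G\<^esub> F)) = card (A \<inter> F)" .
  have fin: "finite (K <#> F)"
    using K F by (auto simp: set_mult_def)
  have "F \<union> (g <#\<^bsub>G\<^esub> F) \<subseteq> K <#> F"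
  proof
    fix x assume "x \<in> F \<union> (g <#\<^bsub>G\<^esub> F)"
    then consider "x \<in> F" | y where "y \<in> F" "x = g \<otimes> y" by (auto simp: l)
    then show "x \<in> K <#> F"
    proof cases
      case 1
      then have "x = \<one> \<otimes> x" using F by auto
      with 1 K(3) show ?thesis unfolding set_mult_def by blast
    next
      case 2
      with K(4) show ?thesis unfolding set_mult_def by blast
    qed
  qed
  then have "card (F \<union> (g <#\<^bsub>G\<^esub> F)) \<le> card (K <#> F)"
    using fin by (rule card_mono[rotated])
  moreover have "\<bar>real (card ((g <#\<^bsub>G\<^esub> A) \<inter> F)) - real (card ((g <#\<^bsub>G\<^esub> A) \<inter> (g <#\<^bsub>G\<^esub> F)))\<bar>
      \<le> real (card (F \<union> (g <#\<^bsub>G\<^esub> F))) - real (card F)"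
    using F c1 by (intro abs_card_Int_diff_le) (auto simp: l)
  ultimately have "\<bar>real (card ((g <#\<^bsub>G\<^esub> A) \<inter> F)) - real (card (A \<inter> F))\<bar> \<le> e * real (card F)"
    using small unfolding c2 by (simp add: algebra_simps)
  moreover have "0 < real (card F)" using F by (simp add: card_gt_0_iff)
  ultimately show ?thesis
    by (simp add: diff_divide_distrib[symmetric] abs_divide pos_divide_le_eq)
qed

text \<open>
  The means on the group form a closed subset of a cube, compact by Tychonoff's theorem, and
  approximate invariance under one \<open>g\<close> on one set \<open>A\<close> is a closed condition. If every finite \<open>K\<close>
  had almost invariant sets, finitely many of these conditions could be met by a uniform measure,
  and compactness would give an exactly invariant mean.
\<close>

theorem finite_expansion_if_not_amenable:
  fixes G :: "('g, 'b) monoid_scheme"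
  assumes "group G" and "\<not> amenable G"
  obtains K e where "finite K" "K \<noteq> {}" "K \<subseteq> carrier G" "0 < (e::real)"
    "\<And>F. \<lbrakk>finite F; F \<noteq> {}; F \<subseteq> carrier G\<rbrakk>
        \<Longrightarrow> (1 + e) * real (card F) \<le> real (card (K <#>\<^bsub>G\<^esub> F))"
proof (rule ccontr)
  assume neg: "\<not> thesis"
  interpret group G by fact
  note witness = that
  have foelner: "\<exists>F. finite F \<and> F \<noteq> {} \<and> F \<subseteq> carrier G \<and>
      real (card (K <#>\<^bsub>G\<^esub> F)) \<le> (1 + e) * real (card F)"
    if K: "finite K" "K \<noteq> {}" "K \<subseteq> carrier G" "0 < e" for K and e :: real
  proof (rule ccontr)
    assume no_set: "\<nexists>F. finite F \<and> F \<noteq> {} \<and> F \<subseteq> carrier G \<and>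
      real (card (K <#>\<^bsub>G\<^esub> F)) \<le> (1 + e) * real (card F)"
    have thesis
      by (rule witness[OF K]) (use no_set in \<open>auto simp: not_le intro: less_imp_le\<close>)
    with neg show False by contradiction
  qed
  define means :: "('g set \<Rightarrow> real) set" where
    "means = PiE UNIV (\<lambda>_. {0..1}) \<inter> ({m. m (carrier G) = 1} \<inter>
      (\<Inter>(A, B) \<in> {(A, B). A \<subseteq> carrier G \<and> B \<subseteq> carrier G \<and> A \<inter> B = {}}.
        {m. m (A \<union> B) = m A + m B}))"
  define almost_inv :: "'g \<times> 'g set \<times> nat \<Rightarrow> ('g set \<Rightarrow> real) set" where
    "almost_inv = (\<lambda>(g, A, n). {m. \<bar>m (g <#\<^bsub>G\<^esub> A) - m A\<bar> \<le> 1 / real (Suc n)})"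
  let ?I = "carrier G \<times> Pow (carrier G) \<times> (UNIV :: nat set)"
  have cont: "continuous_on UNIV (\<lambda>m :: 'g set \<Rightarrow> real. m A)" for A
    by (rule continuous_on_product_coordinates)
  have "closed ({m. m (carrier G) = 1} \<inter>
      (\<Inter>(A, B) \<in> {(A, B). A \<subseteq> carrier G \<and> B \<subseteq> carrier G \<and> A \<inter> B = {}}.
        {m :: 'g set \<Rightarrow> real. m (A \<union> B) = m A + m B}))"
    by (intro closed_Int closed_INT ballI) (auto intro!: closed_Collect_eq continuous_intros cont)
  then have "compact means"
    unfolding means_def by (rule compact_Int_closed[OF compact_unit_cube])
  moreover have "closed (almost_inv i)" for i
    unfolding almost_inv_def
    by (cases i) (auto intro!: closed_Collect_le continuous_intros cont)
  moreover have "means \<inter> (\<Inter>i\<in>I'. almost_inv i) \<noteq> {}" if I': "finite I'" "I' \<subseteq> ?I" for I'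
  proof -
    define K where "K = insert \<one>\<^bsub>G\<^esub> (fst ` I')"
    define N where "N = Max (insert 0 ((\<lambda>(g, A, n). n) ` I'))"
    have K: "finite K" "K \<noteq> {}" "K \<subseteq> carrier G" "\<one>\<^bsub>G\<^esub> \<in> K" using I' by (auto simp: K_def)
    obtain F where F: "finite F" "F \<noteq> {}" "F \<subseteq> carrier G"
      and small: "real (card (K <#>\<^bsub>G\<^esub> F)) \<le> (1 + 1 / real (Suc N)) * real (card F)"
      using foelner[of K "1 / real (Suc N)"] K by auto
    define m where "m = (\<lambda>A. real (card (A \<inter> F)) / real (card F))"
    have pos: "0 < real (card F)" using F by (simp add: card_gt_0_iff)
    have "m \<in> means"
    proof -
      have "m A \<in> {0..1}" for A
        using F pos by (auto simp: m_def divide_le_eq intro!: card_mono)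
      moreover have "m (carrier G) = 1"
        using F pos by (simp add: m_def Int_absorb1)
      moreover have "m (A \<union> B) = m A + m B" if "A \<inter> B = {}" for A B
      proof -
        have "card ((A \<union> B) \<inter> F) = card (A \<inter> F) + card (B \<inter> F)"
          using that F by (subst card_Un_disjoint[symmetric]) (auto simp: Int_Un_distrib2)
        then show ?thesis by (simp add: m_def add_divide_distrib)
      qed
      ultimately show ?thesis by (auto simp: means_def)
    qed
    moreover have "m \<in> almost_inv i" if i: "i \<in> I'" for i
    proof -
      obtain g A n where gAn: "i = (g, A, n)" by (cases i)
      have "n \<le> N" unfolding N_def using I' i gAn by (intro Max_ge) force+
      then have "1 / real (Suc N) \<le> 1 / real (Suc n)" by (simp add: frac_le)
      moreover have "g \<in> K" using i gAn by (force simp: K_def)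
      moreover have "A \<subseteq> carrier G" using i gAn I' by auto
      ultimately have "\<bar>m (g <#\<^bsub>G\<^esub> A) - m A\<bar> \<le> 1 / real (Suc n)"
        using uniform_measure_almost_invariant[OF F K(1,3,4) _ small] unfolding m_def
        by (meson order_trans)
      then show ?thesis by (simp add: almost_inv_def gAn)
    qed
    ultimately show ?thesis by blast
  qed
  ultimately have "means \<inter> (\<Inter>i\<in>?I. almost_inv i) \<noteq> {}"
    by (rule compact_imp_fip_image)
  then obtain m where m: "m \<in> means" and inv: "\<And>i. i \<in> ?I \<Longrightarrow> m \<in> almost_inv i"
    by blast
  have "m (g <#\<^bsub>G\<^esub> A) = m A" if "g \<in> carrier G" "A \<subseteq> carrier G" for g A
  proof -
    have "\<bar>m (g <#\<^bsub>G\<^esub> A) - m A\<bar> \<le> 1 / real (Suc n)" for n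
      using inv[of "(g, A, n)"] that by (simp add: almost_inv_def)
    then have "\<bar>m (g <#\<^bsub>G\<^esub> A) - m A\<bar> \<le> 0"
      by (intro LIMSEQ_le_const[OF LIMSEQ_inverse_real_of_nat]) (auto simp: inverse_eq_divide)
    then show ?thesis by simp
  qed
  with m have "amenable G"
    unfolding amenable_def means_def additive_def
    by (intro exI[of _ m]) (auto simp: PiE_iff)
  with assms show False by simp
qed

section \<open>Joins and preimages of partitions\<close>

text \<open>
  A partition is determined by which points it does not separate. In these terms common
  refinement is conjunction and preimage is substitution, which makes identities between iterated
  joins immediate.
\<close>

definition same_cell :: "'x set set \<Rightarrow> 'x \<Rightarrow> 'x \<Rightarrow> bool" where
  "same_cell P x y \<longleftrightarrow> (\<exists>A\<in>P. x \<in> A \<and> y \<in> A)"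

lemma partition_on_eqI_same_cell:
  assumes "partition_on \<Omega> P" "partition_on \<Omega> Q"
    and "\<And>x y. same_cell P x y \<longleftrightarrow> same_cell Q x y"
  shows "P = Q"
proof -
  have "{(x, y). \<exists>p\<in>P. x \<in> p \<and> y \<in> p} = {(x, y). \<exists>p\<in>Q. x \<in> p \<and> y \<in> p}"
    using assms(3) by (simp add: same_cell_def)
  then have "\<Omega> // {(x, y). \<exists>p\<in>P. x \<in> p \<and> y \<in> p} = \<Omega> // {(x, y). \<exists>p\<in>Q. x \<in> p \<and> y \<in> p}"
    by (rule arg_cong)
  then show ?thesis
    unfolding partition_on_eq_quotient[OF assms(1)] partition_on_eq_quotient[OF assms(2)] .
qed

lemma same_cell_common_refinement:
  "same_cell (common_refinement \<P>) x y \<longleftrightarrow> (\<forall>P\<in>\<P>. same_cell P x y)"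
proof
  assume "\<forall>P\<in>\<P>. same_cell P x y"
  then obtain f where f: "\<And>P. P \<in> \<P> \<Longrightarrow> f P \<in> P \<and> x \<in> f P \<and> y \<in> f P"
    unfolding same_cell_def by metis
  then have "\<Inter> (f ` \<P>) \<in> common_refinement \<P>"
    unfolding common_refinement by auto
  with f show "same_cell (common_refinement \<P>) x y"
    unfolding same_cell_def by (intro bexI[of _ "\<Inter> (f ` \<P>)"]) auto
next
  assume "same_cell (common_refinement \<P>) x y"
  then show "\<forall>P\<in>\<P>. same_cell P x y"
    unfolding same_cell_def by (meson common_refinement_exists subsetD)
qed

text \<open>
  The join of two partitions, written so that every cell comes from a pair of cells: the entropy
  estimates are sums over such pairs.
\<close>

definition join_partition :: "'x set set \<Rightarrow> 'x set set \<Rightarrow> 'x set set" where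
  "join_partition P Q = (\<lambda>(A, B). A \<inter> B) ` (P \<times> Q) - {{}}"

lemma same_cell_join_partition:
  "same_cell (join_partition P Q) x y \<longleftrightarrow> same_cell P x y \<and> same_cell Q x y"
proof
  assume "same_cell P x y \<and> same_cell Q x y"
  then obtain A B where AB: "A \<in> P" "B \<in> Q" and xy: "x \<in> A \<inter> B" "y \<in> A \<inter> B"
    by (auto simp: same_cell_def)
  have "A \<inter> B \<in> (\<lambda>(A, B). A \<inter> B) ` (P \<times> Q)"
    using AB by (intro image_eqI[of _ _ "(A, B)"]) simp_all
  moreover have "A \<inter> B \<notin> {{}}" using xy by auto
  ultimately have "A \<inter> B \<in> join_partition P Q"
    unfolding join_partition_def by (rule DiffI)
  with xy show "same_cell (join_partition P Q) x y"
    unfolding same_cell_def by (intro bexI[of _ "A \<inter> B"] conjI)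
qed (auto simp: same_cell_def join_partition_def)

lemma partition_on_join_partition:
  assumes "partition_on \<Omega> P" "partition_on \<Omega> Q"
  shows "partition_on \<Omega> (join_partition P Q)"
proof (rule partition_onI)
  show "\<Union> (join_partition P Q) = \<Omega>"
    using assms unfolding join_partition_def partition_on_def by blast
next
  fix C D assume "C \<in> join_partition P Q" "D \<in> join_partition P Q" "C \<noteq> D"
  then obtain A B A' B' where "A \<in> P" "B \<in> Q" "C = A \<inter> B" "A' \<in> P" "B' \<in> Q" "D = A' \<inter> B'"
    by (auto simp: join_partition_def)
  with \<open>C \<noteq> D\<close> show "disjnt C D"
    using disjointD[OF partition_onD2[OF assms(1)], of A A']
      disjointD[OF partition_onD2[OF assms(2)], of B B']
    unfolding disjnt_def by blast
qed (auto simp: join_partition_def)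

lemma common_refinement_insert:
  assumes "\<P> \<noteq> {}" "partition_on \<Omega> P" "\<And>Q. Q \<in> \<P> \<Longrightarrow> partition_on \<Omega> Q"
  shows "common_refinement (insert P \<P>) = join_partition P (common_refinement \<P>)"
proof (rule partition_on_eqI_same_cell)
  show "partition_on \<Omega> (common_refinement (insert P \<P>))"
    using assms by (intro partition_on_common_refinement) auto
  show "partition_on \<Omega> (join_partition P (common_refinement \<P>))"
    using assms by (intro partition_on_join_partition partition_on_common_refinement) auto
qed (simp add: same_cell_common_refinement same_cell_join_partition)

lemma same_cell_preimage_partition:
  "same_cell (preimage_partition M f P) x y
    \<longleftrightarrow> x \<in> space M \<and> y \<in> space M \<and> same_cell P (f x) (f y)"
  by (auto simp: same_cell_def preimage_partition_def)

lemma partition_on_preimage_partition: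
  assumes "f ` space M = space M" "partition_on (space M) P"
  shows "partition_on (space M) (preimage_partition M f P)"
proof (rule partition_onI)
  show "\<Union> (preimage_partition M f P) = space M"
    using assms unfolding preimage_partition_def partition_on_def by blast
next
  fix C D assume "C \<in> preimage_partition M f P" "D \<in> preimage_partition M f P" "C \<noteq> D"
  then obtain A B where "A \<in> P" "B \<in> P" "C = f -` A \<inter> space M" "D = f -` B \<inter> space M"
    by (auto simp: preimage_partition_def)
  with \<open>C \<noteq> D\<close> show "disjnt C D"
    using disjointD[OF partition_onD2[OF assms(2)], of A B] unfolding disjnt_def by blast
next
  show "{} \<notin> preimage_partition M f P"
  proof
    assume "{} \<in> preimage_partition M f P"
    then obtain A where A: "A \<in> P" "f -` A \<inter> space M = {}" by (auto simp: preimage_partition_def)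
    then have "A \<noteq> {}" "A \<subseteq> space M" using assms(2) by (auto simp: partition_on_def)
    then obtain y where "y \<in> A" "y \<in> f ` space M" using assms(1) by blast
    with A(2) show False by auto
  qed
qed

section \<open>Entropy of joins and preimages\<close>

lemma (in prob_space) entropy_term_nonneg: "0 \<le> - (measure M A * ln (measure M A))"
proof (cases "measure M A = 0")
  case False
  then have "ln (measure M A) \<le> 0" by (simp add: zero_less_measure_iff)
  then show ?thesis by (simp add: mult_nonneg_nonpos)
qed simp

lemma (in prob_space) shannon_entropy_le_iff:
  "shannon_entropy M P \<le> c \<longleftrightarrow> (\<forall>F. finite F \<longrightarrow> F \<subseteq> P \<longrightarrow>
     ennreal (\<Sum>A\<in>F. - (measure M A * ln (measure M A))) \<le> c)"
proof -
  have "shannon_entropy M P = (SUP F\<in>{F. finite F \<and> F \<subseteq> P}.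
      \<Sum>A\<in>F. ennreal (- (measure M A * ln (measure M A))))"
    unfolding shannon_entropy_def by (rule nonneg_infsum_complete) simp
  then show ?thesis
    by (simp only: sum_ennreal[OF entropy_term_nonneg] SUP_le_iff Ball_def mem_Collect_eq imp_conjL)
qed

text \<open>
  This is \<open>ln x \<le> x - 1\<close> at \<open>x = a b / p\<close>, multiplied by \<open>p\<close>, the pointwise source of the
  nonnegativity of mutual information; the term \<open>- p\<close> is discarded.
\<close>

lemma entropy_term_split_le:
  fixes p a b :: real
  assumes "0 \<le> p" "p \<le> a" "p \<le> b"
  shows "- (p * ln p) \<le> p * - ln a + p * - ln b + a * b"
proof (cases "p = 0")
  case False
  then have pos: "0 < p" "0 < a" "0 < b" using assms by auto
  then have "ln (a * b / p) \<le> a * b / p - 1"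
    by (intro ln_le_minus_one) simp
  then have "p * (ln a + ln b - ln p) \<le> p * (a * b / p - 1)"
    using pos by (intro mult_left_mono) (auto simp: ln_div ln_mult)
  then show ?thesis using pos by (simp add: algebra_simps)
qed (use assms in auto)

lemma (in prob_space) sum_measure_Int_le:
  assumes "A \<in> sets M" "finite F" "F \<subseteq> sets M" "disjoint F"
  shows "(\<Sum>B\<in>F. measure M (A \<inter> B)) \<le> measure M A"
proof -
  have "(\<Sum>B\<in>F. measure M (A \<inter> B)) = measure M (\<Union>B\<in>F. A \<inter> B)"
    using assms by (intro finite_measure_finite_Union[symmetric])
      (auto simp: disjoint_family_on_def disjoint_def)
  also have "\<dots> \<le> measure M A"
    using assms by (intro finite_measure_mono) auto
  finally show ?thesis .
qed

text \<open>
  Shannon entropy is subadditive under joins. The form with an additive error 1 is enough to keep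
  entropies finite, and lets the proof stay with finite subfamilies, whose measures need not add
  up to 1: after summing \<open>entropy_term_split_le\<close> over \<open>A\<close> and \<open>B\<close>, the first two terms contribute at
  most the two entropies and the products \<open>\<mu>(A) \<mu>(B)\<close> contribute at most 1.
\<close>

lemma (in prob_space) shannon_entropy_join_partition_le:
  assumes P: "countable_measurable_partition M P" and Q: "countable_measurable_partition M Q"
  shows "shannon_entropy M (join_partition P Q) \<le> shannon_entropy M P + shannon_entropy M Q + 1"
  unfolding shannon_entropy_le_iff[of "join_partition P Q"]
proof (intro allI impI)
  let ?\<eta> = "\<lambda>A. - (measure M A * ln (measure M A))"
  fix F assume F: "finite F" "F \<subseteq> join_partition P Q"
  then have "F \<subseteq> (\<lambda>(A, B). A \<inter> B) ` (P \<times> Q)" by (auto simp: join_partition_def)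
  then obtain C where C: "C \<subseteq> P \<times> Q" "finite C" "F = (\<lambda>(A, B). A \<inter> B) ` C"
    using finite_subset_image[OF F(1)] by metis
  define D E where "D = fst ` C" and "E = snd ` C"
  have D: "finite D" "D \<subseteq> P" and E: "finite E" "E \<subseteq> Q" and CDE: "C \<subseteq> D \<times> E"
    using C unfolding D_def E_def by (auto intro: rev_image_eqI)
  have ms: "D \<subseteq> sets M" "E \<subseteq> sets M" and disj: "disjoint D" "disjoint E"
    using P Q D E unfolding countable_measurable_partition_def partition_on_def
    by (auto intro: pairwise_subset)
  have total: "(\<Sum>B\<in>F. measure M B) \<le> 1" if "finite F" "F \<subseteq> sets M" "disjoint F" for F
    using sum_measure_Int_le[of "space M" F] that sets.Int_space_eq1
    by (simp add: prob_space subset_iff cong: sum.cong)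
  have marginal: "(\<Sum>A\<in>D. \<Sum>B\<in>E. measure M (A \<inter> B) * - ln (measure M A)) \<le> (\<Sum>A\<in>D. ?\<eta> A)"
    if "D \<subseteq> sets M" "finite E" "E \<subseteq> sets M" "disjoint E" for D E
  proof (intro sum_mono)
    fix A assume "A \<in> D"
    have "(\<Sum>B\<in>E. measure M (A \<inter> B) * - ln (measure M A))
        = (\<Sum>B\<in>E. measure M (A \<inter> B)) * - ln (measure M A)"
      by (rule sum_distrib_right[symmetric])
    also have "\<dots> \<le> measure M A * - ln (measure M A)"
    proof (cases "measure M A = 0")
      case False
      then have "0 \<le> - ln (measure M A)" by (simp add: zero_less_measure_iff)
      then show ?thesis
        using sum_measure_Int_le[of A E] that \<open>A \<in> D\<close> by (intro mult_right_mono) auto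
    qed simp
    finally show "(\<Sum>B\<in>E. measure M (A \<inter> B) * - ln (measure M A)) \<le> ?\<eta> A" by simp
  qed
  have "(\<Sum>A\<in>F. ?\<eta> A) \<le> (\<Sum>(A, B)\<in>C. ?\<eta> (A \<inter> B))"
    unfolding C(3) using C(2) entropy_term_nonneg
    by (intro order_trans[OF sum_image_le]) (auto simp: case_prod_beta simp del: sum_negf)
  also have "\<dots> \<le> (\<Sum>(A, B)\<in>D \<times> E. ?\<eta> (A \<inter> B))"
    using CDE D E entropy_term_nonneg by (intro sum_mono2) auto
  also have "\<dots> = (\<Sum>A\<in>D. \<Sum>B\<in>E. ?\<eta> (A \<inter> B))"
    by (rule sum.cartesian_product[symmetric])
  also have "\<dots> \<le> (\<Sum>A\<in>D. \<Sum>B\<in>E. measure M (A \<inter> B) * - ln (measure M A)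
      + measure M (A \<inter> B) * - ln (measure M B) + measure M A * measure M B)"
    using ms by (intro sum_mono entropy_term_split_le finite_measure_mono) auto
  also have "\<dots> = (\<Sum>A\<in>D. \<Sum>B\<in>E. measure M (A \<inter> B) * - ln (measure M A))
      + (\<Sum>B\<in>E. \<Sum>A\<in>D. measure M (B \<inter> A) * - ln (measure M B))
      + (\<Sum>A\<in>D. measure M A) * (\<Sum>B\<in>E. measure M B)"
    by (simp only: sum.distrib sum_product sum.swap[of _ E D] Int_commute)
  also have "\<dots> \<le> (\<Sum>A\<in>D. ?\<eta> A) + (\<Sum>B\<in>E. ?\<eta> B) + 1"
    using marginal[of D E] marginal[of E D] total[of D] total[of E] ms disj D E
    by (intro add_mono mult_le_one) (auto intro: sum_nonneg simp del: sum_negf)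
  finally have "ennreal (\<Sum>A\<in>F. ?\<eta> A) \<le> ennreal ((\<Sum>A\<in>D. ?\<eta> A) + (\<Sum>B\<in>E. ?\<eta> B) + 1)"
    by (rule ennreal_leI)
  also have "\<dots> = ennreal (\<Sum>A\<in>D. ?\<eta> A) + ennreal (\<Sum>B\<in>E. ?\<eta> B) + 1"
    using entropy_term_nonneg by (simp add: sum_nonneg ennreal_plus del: sum_negf)
  also have "\<dots> \<le> shannon_entropy M P + shannon_entropy M Q + 1"
    using shannon_entropy_le_iff[of P "shannon_entropy M P"]
      shannon_entropy_le_iff[of Q "shannon_entropy M Q"] D E
    by (intro add_mono) auto
  finally show "ennreal (\<Sum>A\<in>F. ?\<eta> A) \<le> shannon_entropy M P + shannon_entropy M Q + 1" .
qed

lemma countable_measurable_partition_join_partition: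
  assumes "countable_measurable_partition M P" "countable_measurable_partition M Q"
  shows "countable_measurable_partition M (join_partition P Q)"
  using assms partition_on_join_partition[of "space M" P Q]
  by (auto simp: countable_measurable_partition_def join_partition_def)

lemma countable_measurable_partition_preimage_partition:
  assumes "f \<in> measurable M M" "f ` space M = space M" "countable_measurable_partition M P"
  shows "countable_measurable_partition M (preimage_partition M f P)"
  using assms partition_on_preimage_partition[of f M P]
  by (auto simp: countable_measurable_partition_def preimage_partition_def)

lemma shannon_entropy_preimage_partition:
  assumes f: "f \<in> measurable M M" "f ` space M = space M" "distr M M f = M"
    and P: "countable_measurable_partition M P"
  shows "shannon_entropy M (preimage_partition M f P) = shannon_entropy M P"
proof -
  have sub: "A \<subseteq> space M" if "A \<in> P" for A
    using P that by (auto simp: countable_measurable_partition_def partition_on_def)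
  have "inj_on (\<lambda>A. f -` A \<inter> space M) P"
  proof (rule inj_onI)
    fix A B assume "A \<in> P" "B \<in> P" "f -` A \<inter> space M = f -` B \<inter> space M"
    moreover have "f ` (f -` A \<inter> space M) = A" if "A \<in> P" for A
    proof
      show "A \<subseteq> f ` (f -` A \<inter> space M)"
      proof
        fix y assume y: "y \<in> A"
        then have "y \<in> f ` space M" using sub[OF that] f(2) by auto
        with y show "y \<in> f ` (f -` A \<inter> space M)" by auto
      qed
    qed auto
    ultimately show "A = B" by metis
  qed
  moreover have "measure M (f -` A \<inter> space M) = measure M A" if "A \<in> P" for A
    using measure_distr[OF f(1), of A] f(3) P that
    by (auto simp: countable_measurable_partition_def)
  ultimately show ?thesis
    unfolding shannon_entropy_def preimage_partition_def
    by (subst infsum_reindex) (auto intro: infsum_cong)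
qed

lemma (in prob_space) common_refinement_finite_entropy:
  assumes "finite \<P>" "\<P> \<noteq> {}"
    and "\<And>P. P \<in> \<P> \<Longrightarrow> countable_measurable_partition M P \<and> shannon_entropy M P < \<infinity>"
  shows "countable_measurable_partition M (common_refinement \<P>) \<and>
    shannon_entropy M (common_refinement \<P>) < \<infinity>"
  using assms
proof (induction \<P> rule: finite_ne_induct)
  case (singleton P)
  moreover have "common_refinement {P} = P"
    using singleton
    by (intro partition_on_eqI_same_cell[of "space M"] partition_on_common_refinement)
       (auto simp: same_cell_common_refinement countable_measurable_partition_def)
  ultimately show ?case by simp
next
  case (insert P \<P>)
  let ?R = "common_refinement \<P>"
  have eq: "common_refinement (insert P \<P>) = join_partition P ?R"
    using insert
    by (intro common_refinement_insert[of _ "space M"]) (auto simp: countable_measurable_partition_def)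
  have P: "countable_measurable_partition M P" "shannon_entropy M P < \<infinity>"
    and R: "countable_measurable_partition M ?R" "shannon_entropy M ?R < \<infinity>"
    using insert by auto
  have "shannon_entropy M (join_partition P ?R) \<le> shannon_entropy M P + shannon_entropy M ?R + 1"
    by (rule shannon_entropy_join_partition_le) fact+
  also have "\<dots> < \<infinity>" using P R by (simp add: less_top[symmetric])
  finally show ?case
    using countable_measurable_partition_join_partition[OF P(1) R(1)] eq by simp
qed

section \<open>Iterated partitions of a measure-preserving action\<close>

locale pmp =
  fixes G :: "('g, 'b) monoid_scheme" (structure) and M :: "'x measure" and T :: "'g \<Rightarrow> 'x \<Rightarrow> 'x"
  assumes pmp: "pmp_action G M T"
begin

sublocale prob_space M
  using pmp by (simp add: pmp_action_def)

sublocale group_action G "space M" T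
  using pmp by (simp add: pmp_action_def)

lemma partition_on_iterated_partition:
  assumes "W \<noteq> {}" "W \<subseteq> carrier G" "partition_on (space M) P"
  shows "partition_on (space M) (iterated_partition M T P W)"
  unfolding iterated_partition_def using assms surj_prop
  by (intro partition_on_common_refinement) (auto intro!: partition_on_preimage_partition)

lemma same_cell_iterated_partition:
  assumes "W \<noteq> {}"
  shows "same_cell (iterated_partition M T P W) x y
    \<longleftrightarrow> x \<in> space M \<and> y \<in> space M \<and> (\<forall>w\<in>W. same_cell P (T w x) (T w y))"
  using assms
  by (auto simp: iterated_partition_def same_cell_common_refinement same_cell_preimage_partition)

text \<open>
  The order of the product matters: \<open>T\<^sup>k\<close> acts after \<open>T\<^sup>f\<close>, so the join runs over the elements
  \<open>k f\<close>, in agreement with the left translates in the expansion property.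
\<close>

lemma iterated_partition_iterated_partition:
  assumes K: "K \<noteq> {}" "K \<subseteq> carrier G" and F: "F \<noteq> {}" "F \<subseteq> carrier G"
    and P: "partition_on (space M) P"
  shows "iterated_partition M T (iterated_partition M T P K) F = iterated_partition M T P (K <#> F)"
proof (rule partition_on_eqI_same_cell)
  interpret group G using group_hom by (simp add: group_hom_def)
  have KF: "K <#> F \<noteq> {}" "K <#> F \<subseteq> carrier G"
    using K F by (auto simp: set_mult_def)
  show "partition_on (space M) (iterated_partition M T P (K <#> F))"
    using KF P by (rule partition_on_iterated_partition)
  show "partition_on (space M) (iterated_partition M T (iterated_partition M T P K) F)"
    using K F P by (intro partition_on_iterated_partition)
  fix x y
  have comp: "T (k \<otimes> f) z = T k (T f z)" if "k \<in> K" "f \<in> F" "z \<in> space M" for k f z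
    using that K F by (intro composition_rule) auto
  have "T f z \<in> space M" if "f \<in> F" "z \<in> space M" for f z
    using that F element_image by blast
  then show "same_cell (iterated_partition M T (iterated_partition M T P K) F) x y \<longleftrightarrow>
      same_cell (iterated_partition M T P (K <#> F)) x y"
    unfolding same_cell_iterated_partition[OF K(1)] same_cell_iterated_partition[OF F(1)]
      same_cell_iterated_partition[OF KF(1)]
    using comp by (auto simp: set_mult_def)
qed

lemma iterated_partition_finite_entropy:
  assumes "finite W" "W \<noteq> {}" "W \<subseteq> carrier G"
    and P: "countable_measurable_partition M P" "shannon_entropy M P < \<infinity>"
  shows "countable_measurable_partition M (iterated_partition M T P W) \<and>
    shannon_entropy M (iterated_partition M T P W) < \<infinity>"
  unfolding iterated_partition_def
proof (rule common_refinement_finite_entropy)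
  fix Q assume "Q \<in> (\<lambda>w. preimage_partition M (T w) P) ` W"
  then obtain w where w: "w \<in> carrier G" "Q = preimage_partition M (T w) P"
    using assms by auto
  have "T w \<in> measurable M M" "distr M M (T w) = M" "T w ` space M = space M"
    using w pmp surj_prop by (auto simp: pmp_action_def)
  then show "countable_measurable_partition M Q \<and> shannon_entropy M Q < \<infinity>"
    using P w(2) countable_measurable_partition_preimage_partition shannon_entropy_preimage_partition
    by metis
qed (use assms in auto)

lemma naive_entropy_partition_mult_card_le:
  assumes "finite W" "W \<noteq> {}" "W \<subseteq> carrier G"
  shows "naive_entropy_partition G M T P * of_nat (card W)
    \<le> shannon_entropy M (iterated_partition M T P W)"
proof -
  let ?n = "of_nat (card W) :: ennreal"
  have "naive_entropy_partition G M T P * ?n \<le> shannon_entropy M (iterated_partition M T P W) / ?n * ?n"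
    unfolding naive_entropy_partition_def using assms by (intro mult_right_mono INF_lower) auto
  also have "\<dots> = shannon_entropy M (iterated_partition M T P W)"
    using assms by (simp add: ennreal_divide_times ennreal_times_divide[symmetric] of_nat_less_top)
  finally show ?thesis .
qed

text \<open>
  Passing from \<open>P\<close> to \<open>P\<^sup>K\<close> turns the window \<open>F\<close> into \<open>K F\<close> while the normalisation is still by
  \<open>|F|\<close>, so the expansion constant of \<open>K\<close> is gained in the naive entropy.
\<close>

lemma naive_entropy_partition_expansion:
  assumes K: "finite K" "K \<noteq> {}" "K \<subseteq> carrier G"
    and expand: "\<And>F. \<lbrakk>finite F; F \<noteq> {}; F \<subseteq> carrier G\<rbrakk>
      \<Longrightarrow> c * real (card F) \<le> real (card (K <#> F))"
    and P: "partition_on (space M) P"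
  shows "ennreal c * naive_entropy_partition G M T P
    \<le> naive_entropy_partition G M T (iterated_partition M T P K)"
  unfolding naive_entropy_partition_def[of G M T "iterated_partition M T P K"]
proof (rule INF_greatest)
  interpret group G using group_hom by (simp add: group_hom_def)
  fix F assume "F \<in> {W. finite W \<and> W \<noteq> {} \<and> W \<subseteq> carrier G}"
  then have F: "finite F" "F \<noteq> {}" "F \<subseteq> carrier G" by auto
  let ?h = "naive_entropy_partition G M T P"
  let ?H = "shannon_entropy M (iterated_partition M T (iterated_partition M T P K) F)"
  have KF: "finite (K <#> F)" "K <#> F \<noteq> {}" "K <#> F \<subseteq> carrier G"
    using K F by (auto simp: set_mult_def)
  have n: "(of_nat (card F) :: ennreal) \<noteq> 0" "(of_nat (card F) :: ennreal) \<noteq> \<infinity>"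
    using F by auto
  have "ennreal c * of_nat (card F) = ennreal (c * real (card F))"
    by (simp add: ennreal_mult'' ennreal_of_nat_eq_real_of_nat)
  also have "\<dots> \<le> of_nat (card (K <#> F))"
    using expand[OF F] by (simp add: ennreal_of_nat_eq_real_of_nat ennreal_leI)
  finally have "ennreal c * ?h * of_nat (card F) \<le> ?h * of_nat (card (K <#> F))"
    by (metis mult.assoc mult.commute mult_left_mono zero_le)
  also have "\<dots> \<le> ?H"
    using naive_entropy_partition_mult_card_le[OF KF]
    by (simp add: iterated_partition_iterated_partition[OF K(2,3) F(2,3) P])
  finally have "ennreal c * ?h * of_nat (card F) / of_nat (card F) \<le> ?H / of_nat (card F)"
    by (rule divide_right_mono_ennreal)
  then show "ennreal c * ?h \<le> ?H / of_nat (card F)"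
    using n by (simp add: ennreal_mult_divide_eq)
qed

end

section \<open>The zero-infinity dichotomy\<close>

theorem theorem2p13:
  fixes G :: "('g, 'b) monoid_scheme"
    and M :: "'x measure"
    and T :: "'g \<Rightarrow> 'x \<Rightarrow> 'x"
  assumes "group G"
    and "countable (carrier G)"
    and "\<not> amenable G"
    and "standard_prob_space M"
    and "pmp_action G M T"
  shows "naive_entropy G M T \<in> {0, \<infinity>}"
proof -
  interpret pmp G M T by standard fact
  obtain K e where K: "finite K" "K \<noteq> {}" "K \<subseteq> carrier G" and e: "0 < (e::real)"
    and expand: "\<And>F. \<lbrakk>finite F; F \<noteq> {}; F \<subseteq> carrier G\<rbrakk>
        \<Longrightarrow> (1 + e) * real (card F) \<le> real (card (K <#>\<^bsub>G\<^esub> F))"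
    using finite_expansion_if_not_amenable[OF assms(1,3)] by blast
  let ?S = "naive_entropy G M T"
  have "ennreal (1 + e) * ?S \<le> ?S"
    unfolding naive_entropy_def[of G M T] SUP_mult_left_ennreal
  proof (rule SUP_least)
    fix P assume "P \<in> {P. countable_measurable_partition M P \<and> shannon_entropy M P < \<infinity>}"
    then have P: "countable_measurable_partition M P" "shannon_entropy M P < \<infinity>" by auto
    let ?Q = "iterated_partition M T P K"
    have "ennreal (1 + e) * naive_entropy_partition G M T P \<le> naive_entropy_partition G M T ?Q"
      using K expand P
      by (intro naive_entropy_partition_expansion) (auto simp: countable_measurable_partition_def)
    also have "\<dots> \<le> (SUP P \<in> {P. countable_measurable_partition M P \<and> shannon_entropy M P < \<infinity>}.
        naive_entropy_partition G M T P)"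
      using iterated_partition_finite_entropy[OF K P] by (intro SUP_upper) auto
    finally show "ennreal (1 + e) * naive_entropy_partition G M T P \<le> \<dots>" .
  qed
  then show ?thesis
  proof (cases ?S)
    case (real s)
    with \<open>ennreal (1 + e) * ?S \<le> ?S\<close> e have "(1 + e) * s \<le> s"
      by (simp add: ennreal_mult[symmetric] del: ennreal_plus)
    with e real have "s = 0"
      by (simp add: algebra_simps mult_le_0_iff)
    with real show ?thesis by simp
  qed simp
qed

end
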